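(* Let $L\ge 0$ be an integer and let $c>\frac{1}{L+1}$ be real. Write $S_N=\sum_{k=1}^N\mathbb P(A_k)$. (1) The inequality $\mathbb P\bigl(\bigcup_{k=1}^N A_k\bigr)\ge 1-\exp(-c\,S_N)$ does not hold universally over the class of $\varphi$-mixing event sequences with $\varphi(L+1)=0$: there exist $N\ge1$, a probability space and events in this class for which it fails. Consequently the constant $\frac1{L+1}$ in the exponent of the bound $$\mathbb P\Bigl(\bigcup_{k=1}^{N}A_k\Bigr)\ge 1-\exp\Bigl(-\frac{1}{L+1}\sum_{k=1}^{N}(\mathbb P(A_k)-\varphi(L+1))_{+}\Bigr)$$ cannot be replaced by $c$, even when restricted to that class. (2) The inequality $\mathbb P\bigl(\bigcup_{k=1}^N A_k\bigr)\ge 1-\exp(-c\,S_N)$ does not hold universally over the class of $\alpha$-mixing event sequences with $\alpha(L+1)=0$: there exist $N\ge1$, a probability space and events in this class for which it fails. Consequently the constant $\frac1{L+1}$ in the exponent of the bound $$\mathbb P\Bigl(\bigcup_{k=1}^{N}A_k\Bigr)\ge\Bigl[1-\exp\Bigl(-\frac{S_N}{L+1}\Bigr)-\Bigl\lceil\frac{N}{L+1}\Bigr\rceil\alpha(L+1)\Bigr]_{+}$$ cannot be replaced by $c$, even when restricted to that class. Both assertions hold under each of the two coefficient conventions (ambient: an infinite sequence $(A_k)_{k\ge1}$ with $\varphi=\varphi_A$, $\alpha=\alpha_A$; finite restricted: a finite family $(A_k)_{1\le k\le N}$ with $\varphi=\varphi_N$, $\alpha=\alpha_N$).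
   Context: Notation: $(x)_+=[x]_+=\max(x,0)$. For sub-$\sigma$-algebras $\mathcal A,\mathcal B$ of a probability space $(\Omega,\mathcal F,\mathbb P)$: $\alpha(\mathcal A,\mathcal B)=\sup\{|\mathbb P(A\cap B)-\mathbb P(A)\mathbb P(B)|: A\in\mathcal A, B\in\mathcal B\}$ and $\varphi(\mathcal A,\mathcal B)=\sup\{|\mathbb P(B\mid A)-\mathbb P(B)|: A\in\mathcal A,\ \mathbb P(A)>0,\ B\in\mathcal B\}$. For integers $a,b\ge1$, $\mathcal F_a^b=\sigma(A_j: a\le j\le b)$ (trivial if $a>b$) and $\mathcal F_a^\infty=\sigma(A_j: j\ge a)$. Ambient coefficients of a sequence $(A_k)_{k\ge1}$: $\alpha_A(n)=\sup_{k\ge1}\alpha(\mathcal F_1^k,\mathcal F_{k+n}^\infty)$, $\varphi_A(n)=\sup_{k\ge1}\varphi(\mathcal F_1^k,\mathcal F_{k+n}^\infty)$. Finite restricted coefficients at horizon $N$: $\alpha_N(n)=\sup_{1\le k\le N}\alpha(\mathcal F_1^k,\mathcal F_{k+n}^N)$, $\varphi_N(n)=\sup_{1\le k\le N}\varphi(\mathcal F_1^k,\mathcal F_{k+n}^N)$, with $\mathcal F_a^N$ trivial when $a>N$. A sequence is $\varphi$-mixing (respectively $\alpha$-mixing) if $\varphi(n)\to0$ (respectively $\alpha(n)\to0$) as $n\to\infty$; for a finite family in the restricted convention this is automatic. *)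

theory Defs
  imports "HOL-Probability.Probability"
begin

text \<open>
  Event sequences are functions \<open>A :: nat \<Rightarrow> 'a set\<close> whose index \<open>0\<close> is never used: the events are
  \<open>A 1, A 2, \<dots>\<close>, and for a finite family of length \<open>N\<close> only \<open>A 1, \<dots>, A N\<close> matter.
  All suprema below are taken in \<^typ>\<open>real\<close>; for a probability space and sub-\<open>\<sigma>\<close>-algebras they
  range over nonempty subsets of \<open>[0, 1]\<close>.
\<close>

definition alpha_coeff :: "'a measure \<Rightarrow> 'a set set \<Rightarrow> 'a set set \<Rightarrow> real" where
  "alpha_coeff M \<A> \<B> =
     Sup {\<bar>measure M (A \<inter> B) - measure M A * measure M B\<bar> | A B. A \<in> \<A> \<and> B \<in> \<B>}"

definition phi_coeff :: "'a measure \<Rightarrow> 'a set set \<Rightarrow> 'a set set \<Rightarrow> real" where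
  "phi_coeff M \<A> \<B> =
     Sup {\<bar>\<P>(\<omega> in M. \<omega> \<in> B \<bar> \<omega> \<in> A) - measure M B\<bar> | A B.
            A \<in> \<A> \<and> measure M A > 0 \<and> B \<in> \<B>}"

text \<open>
  \<open>\<F>\<^sub>a\<^sup>b\<close> is \<open>event_sigma M A {a..b}\<close>, and \<open>\<F>\<^sub>a\<^sup>\<infinity>\<close> is \<open>event_sigma M A {a..}\<close>.
  If \<open>a > b\<close> the generating family is empty and \<open>\<F>\<^sub>a\<^sup>b = {{}, space M}\<close>.
\<close>

definition event_sigma :: "'a measure \<Rightarrow> (nat \<Rightarrow> 'a set) \<Rightarrow> nat set \<Rightarrow> 'a set set" where
  "event_sigma M A J = sigma_sets (space M) (A ` J)"

definition alpha_ambient :: "'a measure \<Rightarrow> (nat \<Rightarrow> 'a set) \<Rightarrow> nat \<Rightarrow> real" where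
  "alpha_ambient M A n =
     (SUP k\<in>{1..}. alpha_coeff M (event_sigma M A {1..k}) (event_sigma M A {k + n..}))"

definition phi_ambient :: "'a measure \<Rightarrow> (nat \<Rightarrow> 'a set) \<Rightarrow> nat \<Rightarrow> real" where
  "phi_ambient M A n =
     (SUP k\<in>{1..}. phi_coeff M (event_sigma M A {1..k}) (event_sigma M A {k + n..}))"

definition alpha_restricted :: "'a measure \<Rightarrow> (nat \<Rightarrow> 'a set) \<Rightarrow> nat \<Rightarrow> nat \<Rightarrow> real" where
  "alpha_restricted M A N n =
     (SUP k\<in>{1..N}. alpha_coeff M (event_sigma M A {1..k}) (event_sigma M A {k + n..N}))"

definition phi_restricted :: "'a measure \<Rightarrow> (nat \<Rightarrow> 'a set) \<Rightarrow> nat \<Rightarrow> nat \<Rightarrow> real" where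
  "phi_restricted M A N n =
     (SUP k\<in>{1..N}. phi_coeff M (event_sigma M A {1..k}) (event_sigma M A {k + n..N}))"

definition phi_class_ambient :: "nat \<Rightarrow> 'a measure \<Rightarrow> (nat \<Rightarrow> 'a set) \<Rightarrow> bool" where
  "phi_class_ambient L M A \<longleftrightarrow>
     prob_space M \<and> (\<forall>k\<ge>1. A k \<in> sets M) \<and>
     phi_ambient M A \<longlonglongrightarrow> 0 \<and> phi_ambient M A (L + 1) = 0"

definition alpha_class_ambient :: "nat \<Rightarrow> 'a measure \<Rightarrow> (nat \<Rightarrow> 'a set) \<Rightarrow> bool" where
  "alpha_class_ambient L M A \<longleftrightarrow>
     prob_space M \<and> (\<forall>k\<ge>1. A k \<in> sets M) \<and>
     alpha_ambient M A \<longlonglongrightarrow> 0 \<and> alpha_ambient M A (L + 1) = 0"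

text \<open>
  For a finite family the limit condition holds automatically, since \<open>\<F>\<^sub>k\<^sub>+\<^sub>n\<^sup>N\<close> is trivial for
  \<open>n \<ge> N\<close>; it is listed for uniformity with the ambient convention.
\<close>

definition phi_class_restricted :: "nat \<Rightarrow> nat \<Rightarrow> 'a measure \<Rightarrow> (nat \<Rightarrow> 'a set) \<Rightarrow> bool" where
  "phi_class_restricted L N M A \<longleftrightarrow>
     prob_space M \<and> (\<forall>k\<in>{1..N}. A k \<in> sets M) \<and>
     phi_restricted M A N \<longlonglongrightarrow> 0 \<and> phi_restricted M A N (L + 1) = 0"

definition alpha_class_restricted :: "nat \<Rightarrow> nat \<Rightarrow> 'a measure \<Rightarrow> (nat \<Rightarrow> 'a set) \<Rightarrow> bool" where
  "alpha_class_restricted L N M A \<longleftrightarrow>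
     prob_space M \<and> (\<forall>k\<in>{1..N}. A k \<in> sets M) \<and>
     alpha_restricted M A N \<longlonglongrightarrow> 0 \<and> alpha_restricted M A N (L + 1) = 0"

text \<open>
  The lower bounds for \<open>\<P>(A\<^sub>1 \<union> \<dots> \<union> A\<^sub>N)\<close> with the constant in the exponent as a parameter \<open>c\<close>;
  \<open>f\<close> and \<open>a\<close> stand for the values \<open>\<phi>(L+1)\<close> and \<open>\<alpha>(L+1)\<close> in either convention.
\<close>

definition phi_lower_bound :: "real \<Rightarrow> real \<Rightarrow> nat \<Rightarrow> 'a measure \<Rightarrow> (nat \<Rightarrow> 'a set) \<Rightarrow> real" where
  "phi_lower_bound c f N M A = 1 - exp (- c * (\<Sum>k=1..N. max 0 (measure M (A k) - f)))"

definition alpha_lower_bound ::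
    "real \<Rightarrow> real \<Rightarrow> nat \<Rightarrow> nat \<Rightarrow> 'a measure \<Rightarrow> (nat \<Rightarrow> 'a set) \<Rightarrow> real" where
  "alpha_lower_bound c a L N M A =
     max 0 (1 - exp (- c * (\<Sum>k=1..N. measure M (A k)))
              - real_of_int \<lceil>real N / (real L + 1)\<rceil> * a)"

end

theory Submission
  imports Defs
begin

text \<open>
  Repeat one event \<open>B\<close> of probability \<open>p\<close> exactly \<open>L + 1\<close> times and continue with empty events.
  Past and future separated by a gap of \<open>L + 1\<close> are independent because the future is trivial,
  while \<open>S\<^sub>N = (L + 1) p\<close> and the union is \<open>B\<close>. With \<open>d = c (L + 1) > 1\<close> the claimed bound would read
  \<open>p \<ge> 1 - exp (- d p)\<close>, which is false for small \<open>p > 0\<close>.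
\<close>

text \<open>The generators already lie in the \<sigma>-algebra \<open>{{}, space M}\<close>. This
  covers a tail of empty events as well as an empty index set \<open>J\<close>.\<close>

lemma event_sigma_trivial:
  assumes "\<And>j. j \<in> J \<Longrightarrow> A j = {}"
  shows "event_sigma M A J = {{}, space M}"
proof
  have "A ` J \<subseteq> {{}, space M}"
    using assms by auto
  then show "event_sigma M A J \<subseteq> {{}, space M}"
    unfolding event_sigma_def by (rule sigma_algebra.sigma_sets_subset[OF sigma_algebra_trivial])
  show "{{}, space M} \<subseteq> event_sigma M A J"
    unfolding event_sigma_def by (auto intro: sigma_sets.Empty sigma_sets_top)
qed

lemma event_sigma_subset_sets:
  assumes "\<And>j. j \<in> J \<Longrightarrow> A j \<in> sets M"
  shows "event_sigma M A J \<subseteq> sets M"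
  unfolding event_sigma_def using assms by (intro sets.sigma_sets_subset) auto

lemma space_in_event_sigma: "space M \<in> event_sigma M A J"
  unfolding event_sigma_def by (rule sigma_sets_top)

context prob_space
begin

text \<open>An event of probability 0 or 1 given by \<open>{}\<close> or \<open>space M\<close> is
  independent of every event, so each deviation vanishes.\<close>

lemma alpha_coeff_trivial_right:
  assumes "\<A> \<subseteq> events" "\<A> \<noteq> {}"
  shows "alpha_coeff M \<A> {{}, space M} = 0"
proof -
  let ?d = "\<lambda>A B. \<bar>prob (A \<inter> B) - prob A * prob B\<bar>"
  have zero: "?d A B = 0" if "A \<in> \<A>" "B \<in> {{}, space M}" for A B
  proof -
    have "A \<subseteq> space M"
      using that(1) assms(1) sets.sets_into_space by blast
    then show ?thesis
      using that(2) by (auto simp: prob_space Int_absorb2)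
  qed
  \<comment> \<open>Deviations equal to 0 do not suffice: the set must also be inhabited, since only
    then does its real supremum equal 0.\<close>
  have "{?d A B | A B. A \<in> \<A> \<and> B \<in> {{}, space M}} = {0}" (is "?S = _")
  proof
    show "?S \<subseteq> {0}"
      using zero by blast
    obtain A where "A \<in> \<A>"
      using assms(2) by blast
    then have "?d A {} \<in> ?S" and "?d A {} = 0"
      using zero by blast+
    then show "{0} \<subseteq> ?S"
      by simp
  qed
  then show ?thesis
    by (simp add: alpha_coeff_def)
qed

text \<open>Conditioning does not change the probability of \<open>{}\<close> or
  \<open>space M\<close>. Membership of \<open>space M\<close> in \<open>\<A>\<close> supplies a
  conditioning event of positive probability, so the supremum ranges over a nonempty set.\<close>

lemma phi_coeff_trivial_right:
  assumes "\<A> \<subseteq> events" "space M \<in> \<A>"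
  shows "phi_coeff M \<A> {{}, space M} = 0"
proof -
  let ?d = "\<lambda>A B. \<bar>\<P>(\<omega> in M. \<omega> \<in> B \<bar> \<omega> \<in> A) - prob B\<bar>"
  have zero: "?d A B = 0" if "prob A > 0" "B \<in> {{}, space M}" "A \<in> \<A>" for A B
  proof -
    have "{\<omega> \<in> space M. \<omega> \<in> A} = A"
      using that assms(1) sets.sets_into_space by blast
    moreover have "{\<omega> \<in> space M. \<omega> \<in> B \<and> \<omega> \<in> A} = (if B = {} then {} else A)"
      using that assms(1) sets.sets_into_space[of A M] by auto
    moreover have "prob B = (if B = {} then 0 else 1)"
      using that(2) by (auto simp: prob_space)
    ultimately show ?thesis
      using that(1) by (simp add: cond_prob_def)
  qed
  have "{?d A B | A B. A \<in> \<A> \<and> prob A > 0 \<and> B \<in> {{}, space M}} = {0}" (is "?S = _")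
  proof
    show "?S \<subseteq> {0}"
      using zero by blast
    have "prob (space M) > 0"
      by (simp add: prob_space)
    then have "?d (space M) {} \<in> ?S" and "?d (space M) {} = 0"
      using assms(2) zero by blast+
    then show "{0} \<subseteq> ?S"
      by simp
  qed
  then show ?thesis
    by (simp add: phi_coeff_def)
qed

lemma coeff_ambient_eq_0:
  assumes "\<And>k. k \<ge> 1 \<Longrightarrow> A k \<in> events" and "\<And>k. k > n \<Longrightarrow> A k = {}"
  shows "alpha_ambient M A n = 0" and "phi_ambient M A n = 0"
proof -
  \<comment> \<open>As \<open>k \<ge> 1\<close>, the future starts strictly after index
    \<open>n\<close>, where all events are empty.\<close>
  have "event_sigma M A {k + n..} = {{}, space M}" if "k \<ge> 1" for k
    using that assms(2) by (intro event_sigma_trivial) auto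
  moreover have "event_sigma M A {1..k} \<subseteq> events" for k
    using assms(1) by (intro event_sigma_subset_sets) auto
  moreover have "event_sigma M A {1..k} \<noteq> {}" for k
    using space_in_event_sigma by blast
  ultimately show "alpha_ambient M A n = 0" and "phi_ambient M A n = 0"
    by (simp_all add: alpha_ambient_def phi_ambient_def alpha_coeff_trivial_right
        phi_coeff_trivial_right space_in_event_sigma)
qed

lemma coeff_restricted_eq_0:
  assumes "N \<ge> 1" and "\<And>k. k \<in> {1..N} \<Longrightarrow> A k \<in> events"
    and "\<And>k. k \<in> {n<..N} \<Longrightarrow> A k = {}"
  shows "alpha_restricted M A N n = 0" and "phi_restricted M A N n = 0"
proof -
  have "event_sigma M A {k + n..N} = {{}, space M}" if "k \<ge> 1" for k
    using that assms(3) by (intro event_sigma_trivial) auto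
  moreover have "event_sigma M A {1..k} \<subseteq> events" if "k \<le> N" for k
    using that assms(2) by (intro event_sigma_subset_sets) auto
  moreover have "event_sigma M A {1..k} \<noteq> {}" for k
    using space_in_event_sigma by blast
  ultimately show "alpha_restricted M A N n = 0" and "phi_restricted M A N n = 0"
    \<comment> \<open>\<open>N \<ge> 1\<close> makes the range of the supremum nonempty, so that the
      supremum of the constant 0 is 0.\<close>
    using assms(1)
    by (simp_all add: alpha_restricted_def phi_restricted_def alpha_coeff_trivial_right
        phi_coeff_trivial_right space_in_event_sigma)
qed

lemma classes_ambient:
  assumes "\<And>k. k \<ge> 1 \<Longrightarrow> A k \<in> events" and "\<And>k. k > L + 1 \<Longrightarrow> A k = {}"
  shows "alpha_class_ambient L M A" and "phi_class_ambient L M A"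
proof -
  \<comment> \<open>Vanishing at all gaps from \<open>L + 1\<close> on gives both the required zero
    and, by eventual constancy, the limit.\<close>
  have z: "alpha_ambient M A n = 0" "phi_ambient M A n = 0" if "n \<ge> L + 1" for n
    using that assms by (intro coeff_ambient_eq_0; simp)+
  show "alpha_class_ambient L M A" "phi_class_ambient L M A"
    unfolding alpha_class_ambient_def phi_class_ambient_def
    using z assms(1) prob_space_axioms
    by (auto intro!: tendsto_eventually eventually_sequentiallyI[of "L + 1"])
qed

lemma classes_restricted:
  assumes "N \<ge> 1" and "\<And>k. k \<in> {1..N} \<Longrightarrow> A k \<in> events"
    and "\<And>k. k \<in> {L + 1<..N} \<Longrightarrow> A k = {}"
  shows "alpha_class_restricted L N M A" and "phi_class_restricted L N M A"
proof -
  have z: "alpha_restricted M A N n = 0" "phi_restricted M A N n = 0" if "n \<ge> L + 1" for n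
    using that assms by (intro coeff_restricted_eq_0; simp)+
  show "alpha_class_restricted L N M A" "phi_class_restricted L N M A"
    unfolding alpha_class_restricted_def phi_class_restricted_def
    using z assms(2) prob_space_axioms
    by (auto intro!: tendsto_eventually eventually_sequentiallyI[of "L + 1"])
qed

end

text \<open>At \<open>p = 0\<close> both sides equal 1, with slopes \<open>- d\<close> and
  \<open>- 1\<close>, so the exponential drops below the line just to the right of 0.\<close>

lemma ex_exp_neg_mult_less:
  fixes d :: real
  assumes "d > 1"
  shows "\<exists>p. 0 \<le> p \<and> p \<le> 1 \<and> exp (- d * p) < 1 - p"
proof (intro exI conjI)
  \<comment> \<open>By \<open>exp (d * p) \<ge> 1 + d * p\<close> it is enough that
    \<open>(1 + d * p) * (1 - p) > 1\<close>, which holds for \<open>0 < p < (d - 1) / d\<close>;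
    the witness is the midpoint of this interval.\<close>
  let ?p = "(d - 1) / (2 * d)"
  show "0 \<le> ?p" "?p \<le> 1"
    using assms by (simp_all add: field_simps)
  have "exp (- d * ?p) = 1 / exp ((d - 1) / 2)"
    using assms by (simp add: exp_minus inverse_eq_divide)
  also have "\<dots> \<le> 1 / (1 + (d - 1) / 2)"
    using assms exp_ge_add_one_self[of "(d - 1) / 2"] by (intro frac_le add_pos_pos) auto
  also have "\<dots> = 2 / (d + 1)"
    using assms by (simp add: field_simps)
  also have "\<dots> < (d + 1) / (2 * d)"
  proof -
    have "(d + 1) * (d + 1) - 4 * d = (d - 1)\<^sup>2"
      by (simp add: power2_eq_square algebra_simps)
    moreover have "(d - 1)\<^sup>2 > 0"
      using assms by simp
    ultimately have "4 * d < (d + 1) * (d + 1)"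
      by linarith
    then show ?thesis
      using assms by (simp add: divide_simps)
  qed
  also have "\<dots> = 1 - ?p"
    using assms by (simp add: field_simps)
  finally show "exp (- d * ?p) < 1 - ?p" .
qed

text \<open>A single pair \<open>M\<close>, \<open>A\<close> with horizon \<open>N = L + 1\<close>
  refutes the bound in all four classes at once.\<close>

lemma ex_counterexample:
  fixes L :: nat and c :: real
  assumes "c > 1 / (real L + 1)"
  obtains M :: "nat measure" and A where
    "phi_class_ambient L M A" "phi_class_restricted L (L + 1) M A"
    "alpha_class_ambient L M A" "alpha_class_restricted L (L + 1) M A"
    "measure M (\<Union>k\<in>{1..L + 1}. A k) < 1 - exp (- c * (\<Sum>k=1..L + 1. measure M (A k)))"
proof -
  have "c * (real L + 1) > 1"
    using assms by (simp add: divide_simps add_pos_nonneg mult.commute split: if_splits)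
  then obtain p where p: "0 \<le> p" "p \<le> 1" "exp (- (c * (real L + 1)) * p) < 1 - p"
    using ex_exp_neg_mult_less by blast
  \<comment> \<open>A coin with success probability \<open>p\<close>, coded in the naturals; the
    repeated event is \<open>{1}\<close>. All subsets are measurable.\<close>
  define M where "M = measure_pmf (map_pmf of_bool (bernoulli_pmf p) :: nat pmf)"
  define A :: "nat \<Rightarrow> nat set" where "A k = (if k \<le> L + 1 then {1} else {})" for k
  interpret prob_space M
    unfolding M_def by (rule measure_pmf.prob_space_axioms)
  have events: "X \<in> sets M" for X
    by (simp add: M_def)
  have "of_bool -` {1 :: nat} = {True}"
    by (auto simp: of_bool_def split: if_splits)
  then have B: "measure M {1} = p"
    using p by (simp add: M_def pmf_map measure_pmf_single)
  have "(\<Union>k\<in>{1..L + 1}. A k) = {1}"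
    by (auto simp: A_def)
  moreover have "(\<Sum>k=1..L + 1. measure M (A k)) = (real L + 1) * p"
    using B by (simp add: A_def)
  ultimately have "measure M (\<Union>k\<in>{1..L + 1}. A k) < 1 - exp (- c * (\<Sum>k=1..L + 1. measure M (A k)))"
    using p(3) B by (simp add: mult.assoc)
  moreover have "alpha_class_ambient L M A" "phi_class_ambient L M A"
    using events by (intro classes_ambient; simp add: A_def)+
  moreover have "alpha_class_restricted L (L + 1) M A" "phi_class_restricted L (L + 1) M A"
    using events by (intro classes_restricted; simp add: A_def)+
  ultimately show thesis
    using that by blast
qed

theorem corollary3p6:
  fixes L :: nat and c :: real
  assumes "c > 1 / (real L + 1)"
  shows
    "(\<exists>N\<ge>1. \<exists>(M :: nat measure) A. phi_class_ambient L M A \<and>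
        \<not> measure M (\<Union>k\<in>{1..N}. A k) \<ge> 1 - exp (- c * (\<Sum>k=1..N. measure M (A k)))) \<and>
     \<not> (\<forall>N\<ge>1. \<forall>(M :: nat measure) A. phi_class_ambient L M A \<longrightarrow>
        measure M (\<Union>k\<in>{1..N}. A k) \<ge> phi_lower_bound c (phi_ambient M A (L + 1)) N M A) \<and>
     (\<exists>N\<ge>1. \<exists>(M :: nat measure) A. phi_class_restricted L N M A \<and>
        \<not> measure M (\<Union>k\<in>{1..N}. A k) \<ge> 1 - exp (- c * (\<Sum>k=1..N. measure M (A k)))) \<and>
     \<not> (\<forall>N\<ge>1. \<forall>(M :: nat measure) A. phi_class_restricted L N M A \<longrightarrow>
        measure M (\<Union>k\<in>{1..N}. A k) \<ge> phi_lower_bound c (phi_restricted M A N (L + 1)) N M A) \<and>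
     (\<exists>N\<ge>1. \<exists>(M :: nat measure) A. alpha_class_ambient L M A \<and>
        \<not> measure M (\<Union>k\<in>{1..N}. A k) \<ge> 1 - exp (- c * (\<Sum>k=1..N. measure M (A k)))) \<and>
     \<not> (\<forall>N\<ge>1. \<forall>(M :: nat measure) A. alpha_class_ambient L M A \<longrightarrow>
        measure M (\<Union>k\<in>{1..N}. A k) \<ge> alpha_lower_bound c (alpha_ambient M A (L + 1)) L N M A) \<and>
     (\<exists>N\<ge>1. \<exists>(M :: nat measure) A. alpha_class_restricted L N M A \<and>
        \<not> measure M (\<Union>k\<in>{1..N}. A k) \<ge> 1 - exp (- c * (\<Sum>k=1..N. measure M (A k)))) \<and>
     \<not> (\<forall>N\<ge>1. \<forall>(M :: nat measure) A. alpha_class_restricted L N M A \<longrightarrow>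
        measure M (\<Union>k\<in>{1..N}. A k) \<ge> alpha_lower_bound c (alpha_restricted M A N (L + 1)) L N M A)"
proof -
  obtain M :: "nat measure" and A where
    classes: "phi_class_ambient L M A" "phi_class_restricted L (L + 1) M A"
      "alpha_class_ambient L M A" "alpha_class_restricted L (L + 1) M A"
    and less: "measure M (\<Union>k\<in>{1..L + 1}. A k)
      < 1 - exp (- c * (\<Sum>k=1..L + 1. measure M (A k)))"
    using ex_counterexample[OF assms] by metis
  have coeffs: "phi_ambient M A (L + 1) = 0" "phi_restricted M A (L + 1) (L + 1) = 0"
    "alpha_ambient M A (L + 1) = 0" "alpha_restricted M A (L + 1) (L + 1) = 0"
    using classes by (simp_all add: phi_class_ambient_def phi_class_restricted_def
        alpha_class_ambient_def alpha_class_restricted_def)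
  \<comment> \<open>With coefficient 0 the positive parts are the probabilities themselves, so this
    bound is the plain one.\<close>
  have phi: "\<not> measure M (\<Union>k\<in>{1..L + 1}. A k) \<ge> phi_lower_bound c 0 (L + 1) M A"
    using less by (simp add: phi_lower_bound_def max_absorb2)
  \<comment> \<open>The correction term vanishes, and truncation at 0 can only raise the bound, so
    the violation persists.\<close>
  have alpha: "\<not> measure M (\<Union>k\<in>{1..L + 1}. A k) \<ge> alpha_lower_bound c 0 L (L + 1) M A"
    using less by (simp add: alpha_lower_bound_def)
  \<comment> \<open>Keeping \<open>P\<close> and \<open>Q\<close> abstract lets \<open>ex\<close>
    and \<open>not_all\<close> settle all eight conjuncts with the same witnesses.\<close>
  have ex: "\<exists>N\<ge>1. \<exists>(M :: nat measure) A. P N M A \<and> Q N M A"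
    if "P (L + 1) M A" "Q (L + 1) M A" for P Q :: "nat \<Rightarrow> nat measure \<Rightarrow> (nat \<Rightarrow> nat set) \<Rightarrow> bool"
    using that le_add2[of 1 L] by blast
  have not_all: "\<not> (\<forall>N\<ge>1. \<forall>(M :: nat measure) A. P N M A \<longrightarrow> Q N M A)"
    if "P (L + 1) M A" "\<not> Q (L + 1) M A" for P Q :: "nat \<Rightarrow> nat measure \<Rightarrow> (nat \<Rightarrow> nat set) \<Rightarrow> bool"
    using ex[of P "\<lambda>N M A. \<not> Q N M A"] that by blast
  show ?thesis
    by (intro conjI ex not_all) (simp_all only: classes coeffs phi alpha less[folded not_le] not_False_eq_True)
qed

end
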